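(* Let $\omega\in[0,1]$, let $c_w\in(0,1)$, and let $c_\mu,c_{xs}$ be constants with $c_\mu+c_{xs}\le1$ such that $$\mu(\mathbf{q}_o)\le c_\mu\,\mu(\mathbf{q}_c),\qquad (1-\omega)\left(\frac{\mathbf{e}^T(\mathbf{x}_o+\mathbf{s}_o)}{k}+1\right)=c_{xs}.$$ If $c_w\ge c_\mu+c_{xs}$, then the warm starting point $\mathbf{q}_w$ satisfies $$\mu(\mathbf{q}_w)\le c_w\,\mu(\mathbf{q}_c).$$
   Context: $\mathcal{K}=\mathcal{K}^1\times\cdots\times\mathcal{K}^k\subset\mathbb{R}^n$ is a product of $k$ second-order cones $\{\mathbf{v}\in\mathbb{R}^{n_i}:\mathbf{v}_1\ge\|\mathbf{v}_{2:n_i}\|\}$ (equal to $[0,\infty)$ if $n_i=1$), and $\mathbf{e}=(\mathbf{e}^{(1)},\dots,\mathbf{e}^{(k)})$ with $\mathbf{e}^{(i)}=(1,0,\dots,0)^T\in\mathbb{R}^{n_i}$. Let $(\mathbf{x}_o,\mathbf{y}_o,\mathbf{s}_o)$, with $\mathbf{x}_o,\mathbf{s}_o\in\mathcal{K}$, $\mathbf{y}_o\in\mathbb{R}^p$, be an inexact solution (only approximately satisfying the equality constraints) of a previously solved second-order cone program over $\mathcal{K}$ and its dual; its central path coefficient is $\mu(\mathbf{q}_o)=\mathbf{x}_o^T\mathbf{s}_o/k$. For a point $\mathbf{q}=(\mathbf{x},\mathbf{y},\mathbf{s},\kappa,\tau)$ put $\mu(\mathbf{q})=(\mathbf{x}^T\mathbf{s}+\kappa\tau)/(k+1)$.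 The cold starting point is $\mathbf{q}_c=(\mathbf{e},0,\mathbf{e},1,1)$, so that $\mu(\mathbf{q}_c)=1$. The warm starting point $\mathbf{q}_w=(\mathbf{x}_w,\mathbf{y}_w,\mathbf{s}_w,\kappa_w,\tau_w)$ is $\mathbf{x}_w=\omega\mathbf{x}_o+(1-\omega)\mathbf{e}$, $\mathbf{y}_w=\omega\mathbf{y}_o$, $\mathbf{s}_w=\omega\mathbf{s}_o+(1-\omega)\mathbf{e}$, $\kappa_w=\mathbf{x}_w^T\mathbf{s}_w/k$, $\tau_w=1$. *)

theory Defs
  imports "Jordan_Normal_Form.Matrix" "HOL-Analysis.L2_Norm"
begin

text \<open>The list \<open>ns\<close> holds the cone dimensions \<open>n\<^sub>1, \<dots>, n\<^sub>k\<close>, so \<open>k = length ns\<close> and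
  \<open>n = sum_list ns\<close>. Vector indices start at 0, so the leading coordinate of a block is
  \<open>v $ 0\<close>, and \<open>unit_vec m 0\<close> is \<open>(1, 0, \<dots>, 0)\<close>.\<close>

definition second_order_cone :: "nat \<Rightarrow> real vec set" where
  "second_order_cone m = {v \<in> carrier_vec m. v $ 0 \<ge> L2_set (\<lambda>j. v $ j) {1..<m}}"

primrec cone_product :: "nat list \<Rightarrow> real vec set" where
  "cone_product [] = {vNil}"
| "cone_product (m # ns) =
    {u @\<^sub>v v | u v. u \<in> second_order_cone m \<and> v \<in> cone_product ns}"

primrec cone_identity :: "nat list \<Rightarrow> real vec" where
  "cone_identity [] = vNil"
| "cone_identity (m # ns) = unit_vec m 0 @\<^sub>v cone_identity ns"

lemma second_order_cone_1: "second_order_cone 1 = {v \<in> carrier_vec 1. v $ 0 \<ge> 0}"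
  by (simp add: second_order_cone_def)

record primal_dual_point =
  pt_x :: "real vec"
  pt_y :: "real vec"
  pt_s :: "real vec"

record embedded_point = primal_dual_point +
  pt_kappa :: real
  pt_tau :: real

text \<open>The central path coefficient has two forms: without the variables \<open>\<kappa>, \<tau>\<close> for a
  solution of the cone program, and with them for a point of the homogeneous embedding.\<close>

definition solution_mu :: "nat \<Rightarrow> primal_dual_point \<Rightarrow> real" where
  "solution_mu k q = (pt_x q \<bullet> pt_s q) / real k"

definition central_mu :: "nat \<Rightarrow> embedded_point \<Rightarrow> real" where
  "central_mu k q = (pt_x q \<bullet> pt_s q + pt_kappa q * pt_tau q) / (real k + 1)"

definition cold_start :: "nat list \<Rightarrow> nat \<Rightarrow> embedded_point" where
  "cold_start ns p =
    \<lparr> pt_x = cone_identity ns, pt_y = 0\<^sub>v p, pt_s = cone_identity ns,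
      pt_kappa = 1, pt_tau = 1 \<rparr>"

definition warm_start :: "nat list \<Rightarrow> real \<Rightarrow> primal_dual_point \<Rightarrow> embedded_point" where
  "warm_start ns \<omega> q =
    (let e = cone_identity ns;
         x = \<omega> \<cdot>\<^sub>v pt_x q + (1 - \<omega>) \<cdot>\<^sub>v e;
         s = \<omega> \<cdot>\<^sub>v pt_s q + (1 - \<omega>) \<cdot>\<^sub>v e
     in \<lparr> pt_x = x, pt_y = \<omega> \<cdot>\<^sub>v pt_y q, pt_s = s,
          pt_kappa = (x \<bullet> s) / real (length ns), pt_tau = 1 \<rparr>)"

end

theory Submission
  imports Defs
begin

text \<open>Write \<open>e\<close> for the cone identity. Since \<open>e \<bullet> e = k\<close>, the cold start has central path
  coefficient 1. The choice \<open>\<kappa>\<^sub>w = (x\<^sub>w \<bullet> s\<^sub>w) / k\<close> turns the average over \<open>k + 1\<close>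
  complementarity terms back into an average over \<open>k\<close>, so the warm start has coefficient
  \<open>(x\<^sub>w \<bullet> s\<^sub>w) / k\<close>. Expanding this bilinearly, with \<open>A = (e \<bullet> (x\<^sub>o + s\<^sub>o)) / k\<close>, gives
  \<open>\<omega>\<^sup>2 \<mu>\<^sub>o + (1 - \<omega>) (\<omega> A + (1 - \<omega>))\<close>.

  Both \<open>\<mu>\<^sub>o\<close> and \<open>A\<close> are nonnegative, because two vectors of the cone have nonnegative
  scalar product (\<open>scalar_prod_cone_product_nonneg\<close>) and \<open>e\<close> itself lies in the cone.
  Hence replacing \<open>\<omega>\<close> by 1 in \<open>\<omega>\<^sup>2 \<mu>\<^sub>o\<close>, and both coefficients \<open>\<omega>\<close> and \<open>1 - \<omega>\<close> by 1 in the
  second factor, can only increase the value; the result is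
  \<open>\<mu>\<^sub>o + (1 - \<omega>) (A + 1) \<le> c\<^sub>\<mu> + c\<^sub>x\<^sub>s \<le> c\<^sub>w\<close>.\<close>

text \<open>By Cauchy-Schwarz the trailing coordinates contribute at least minus the product of their
  norms, and the leading coordinates dominate these norms.\<close>

lemma scalar_prod_second_order_cone_nonneg:
  assumes u: "u \<in> second_order_cone m" and v: "v \<in> second_order_cone m"
  shows "0 \<le> u \<bullet> v"
proof (cases "m = 0")
  case True
  then show ?thesis
    using v by (auto simp: second_order_cone_def scalar_prod_def)
next
  case False
  let ?J = "{1..<m}"
  have "dim_vec v = m"
    using v by (auto simp: second_order_cone_def)
  then have split: "u \<bullet> v = u $ 0 * v $ 0 + (\<Sum>j\<in>?J. u $ j * v $ j)"
    using False by (simp add: scalar_prod_def sum.atLeast_Suc_lessThan)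
  have "- (\<Sum>j\<in>?J. u $ j * v $ j) = (\<Sum>j\<in>?J. - (u $ j * v $ j))"
    by (simp add: sum_negf)
  also have "\<dots> \<le> (\<Sum>j\<in>?J. \<bar>u $ j\<bar> * \<bar>v $ j\<bar>)"
    by (rule sum_mono) (metis abs_ge_minus_self abs_mult)
  also have "\<dots> \<le> L2_set (\<lambda>j. u $ j) ?J * L2_set (\<lambda>j. v $ j) ?J"
    by (rule L2_set_mult_ineq)
  also have "\<dots> \<le> u $ 0 * v $ 0"
  proof (rule mult_mono)
    show u0: "L2_set (\<lambda>j. u $ j) ?J \<le> u $ 0" and "L2_set (\<lambda>j. v $ j) ?J \<le> v $ 0"
      using u v by (simp_all add: second_order_cone_def)
    show "0 \<le> u $ 0"
      using u0 L2_set_nonneg order_trans by blast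
  qed (rule L2_set_nonneg)
  finally show ?thesis
    using split by linarith
qed

lemma cone_product_carrier:
  "v \<in> cone_product ns \<Longrightarrow> v \<in> carrier_vec (sum_list ns)"
  by (induction ns arbitrary: v) (auto simp: second_order_cone_def)

lemma scalar_prod_cone_product_nonneg:
  assumes "u \<in> cone_product ns" and "v \<in> cone_product ns"
  shows "0 \<le> u \<bullet> v"
  using assms
proof (induction ns arbitrary: u v)
  case Nil
  then show ?case by (simp add: scalar_prod_def)
next
  case (Cons m ns)
  obtain u1 u2 where u: "u = u1 @\<^sub>v u2" "u1 \<in> second_order_cone m" "u2 \<in> cone_product ns"
    using Cons.prems(1) by auto
  obtain v1 v2 where v: "v = v1 @\<^sub>v v2" "v1 \<in> second_order_cone m" "v2 \<in> cone_product ns"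
    using Cons.prems(2) by auto
  have "u1 \<in> carrier_vec m" "v1 \<in> carrier_vec m"
    using u(2) v(2) by (simp_all add: second_order_cone_def)
  then have "u \<bullet> v = u1 \<bullet> v1 + u2 \<bullet> v2"
    using u v scalar_prod_append cone_product_carrier by blast
  then show ?case
    using Cons.IH u v scalar_prod_second_order_cone_nonneg by simp
qed

lemma unit_vec_in_second_order_cone:
  assumes "m \<ge> 1"
  shows "unit_vec m 0 \<in> second_order_cone m"
proof -
  have "L2_set (\<lambda>j. (unit_vec m 0 :: real vec) $ j) {1..<m} = 0"
    by (rule L2_set_eq_0_iff[THEN iffD2]) (use assms in \<open>auto simp: unit_vec_def\<close>)
  then show ?thesis
    using assms by (simp add: second_order_cone_def)
qed

lemma cone_identity_in_cone_product:
  "\<forall>m \<in> set ns. m \<ge> 1 \<Longrightarrow> cone_identity ns \<in> cone_product ns"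
  by (induction ns) (auto 4 4 intro: unit_vec_in_second_order_cone[simplified])

lemma cone_identity_carrier: "cone_identity ns \<in> carrier_vec (sum_list ns)"
  by (induction ns) auto

lemma scalar_prod_cone_identity:
  "\<forall>m \<in> set ns. m \<ge> 1 \<Longrightarrow> cone_identity ns \<bullet> cone_identity ns = real (length ns)"
proof (induction ns)
  case Nil
  then show ?case by (simp add: scalar_prod_def)
next
  case (Cons m ns)
  have "cone_identity (m # ns) \<bullet> cone_identity (m # ns) =
      unit_vec m 0 \<bullet> unit_vec m 0 + cone_identity ns \<bullet> cone_identity ns"
    unfolding cone_identity.simps
    by (rule scalar_prod_append[OF unit_vec_carrier cone_identity_carrier
          unit_vec_carrier cone_identity_carrier])
  then show ?case
    using Cons by simp
qed

lemma central_mu_cold_start: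
  assumes "\<forall>m \<in> set ns. m \<ge> 1"
  shows "central_mu (length ns) (cold_start ns p) = 1"
  using scalar_prod_cone_identity[OF assms] by (simp add: central_mu_def cold_start_def)

text \<open>The embedding variables of the warm start add exactly one more term equal to the mean of
  the others, which leaves the mean unchanged.\<close>

lemma central_mu_warm_start:
  assumes "ns \<noteq> []"
  shows "central_mu (length ns) (warm_start ns \<omega> q) =
    ((\<omega> \<cdot>\<^sub>v pt_x q + (1 - \<omega>) \<cdot>\<^sub>v cone_identity ns) \<bullet>
     (\<omega> \<cdot>\<^sub>v pt_s q + (1 - \<omega>) \<cdot>\<^sub>v cone_identity ns)) / real (length ns)"
proof -
  have "(a + a / k) / (k + 1) = a / k" if "k > 0" for a k :: real
    using that by (simp add: divide_simps) (simp add: algebra_simps)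
  then show ?thesis
    using assms by (simp add: central_mu_def warm_start_def Let_def)
qed

lemma scalar_prod_convex_combination:
  fixes x s e :: "real vec"
  assumes [simp]: "x \<in> carrier_vec n" "s \<in> carrier_vec n" "e \<in> carrier_vec n"
  shows "(\<omega> \<cdot>\<^sub>v x + (1 - \<omega>) \<cdot>\<^sub>v e) \<bullet> (\<omega> \<cdot>\<^sub>v s + (1 - \<omega>) \<cdot>\<^sub>v e) =
    \<omega>\<^sup>2 * (x \<bullet> s) + \<omega> * (1 - \<omega>) * (e \<bullet> (x + s)) + (1 - \<omega>)\<^sup>2 * (e \<bullet> e)"
proof -
  have "x \<bullet> e = e \<bullet> x"
    by (rule comm_scalar_prod[of _ n]) simp_all
  then show ?thesis
    by (simp add: add_scalar_prod_distrib[of _ n] scalar_prod_add_distrib[of _ n]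
        smult_scalar_prod_distrib[of _ n] scalar_prod_smult_distrib[of _ n]
        power2_eq_square distrib_left)
qed

theorem mainTheorem5:
  fixes ns :: "nat list" and p :: nat
    and q_o :: primal_dual_point
    and \<omega> c_w c_\<mu> c_xs :: real
  defines "k \<equiv> length ns"
    and "e \<equiv> cone_identity ns"
    and "q_c \<equiv> cold_start ns p"
    and "q_w \<equiv> warm_start ns \<omega> q_o"
  assumes "k \<ge> 1" and "\<forall>m \<in> set ns. m \<ge> 1"
    and "pt_x q_o \<in> cone_product ns" and "pt_s q_o \<in> cone_product ns"
    and "pt_y q_o \<in> carrier_vec p"
    and "0 \<le> \<omega>" and "\<omega> \<le> 1"
    and "0 < c_w" and "c_w < 1"
    and "c_\<mu> + c_xs \<le> 1"
    and "solution_mu k q_o \<le> c_\<mu> * central_mu k q_c"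
    and "(1 - \<omega>) * ((e \<bullet> (pt_x q_o + pt_s q_o)) / real k + 1) = c_xs"
    and "c_w \<ge> c_\<mu> + c_xs"
  shows "central_mu k q_w \<le> c_w * central_mu k q_c"
proof -
  have ns: "ns \<noteq> []" and k: "real k > 0"
    using assms(5) by (auto simp: k_def)
  let ?x = "pt_x q_o" and ?s = "pt_s q_o"
  define A where "A = (e \<bullet> (?x + ?s)) / real k"
  define M where "M = solution_mu k q_o"
  note carrier = cone_product_carrier[OF assms(7)] cone_product_carrier[OF assms(8)]
    cone_identity_carrier[of ns]
  have cold: "central_mu k q_c = 1"
    using central_mu_cold_start[OF assms(6)] by (simp add: k_def q_c_def)
  have "e \<in> cone_product ns"
    using cone_identity_in_cone_product[OF assms(6)] by (simp add: e_def)
  then have "0 \<le> e \<bullet> ?x" and "0 \<le> e \<bullet> ?s"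
    using assms(7,8) by (auto intro: scalar_prod_cone_product_nonneg)
  moreover have "e \<bullet> (?x + ?s) = e \<bullet> ?x + e \<bullet> ?s"
    using carrier by (simp add: e_def scalar_prod_add_distrib)
  ultimately have A: "0 \<le> A"
    by (simp add: A_def)
  have M: "0 \<le> M"
    using scalar_prod_cone_product_nonneg[OF assms(7,8)] by (simp add: M_def solution_mu_def)
  have "central_mu k q_w =
      (\<omega>\<^sup>2 * (?x \<bullet> ?s) + \<omega> * (1 - \<omega>) * (e \<bullet> (?x + ?s)) + (1 - \<omega>)\<^sup>2 * (e \<bullet> e)) / real k"
    using central_mu_warm_start[OF ns] scalar_prod_convex_combination[OF carrier]
    by (simp add: k_def e_def q_w_def)
  also have "e \<bullet> e = real k"
    using scalar_prod_cone_identity[OF assms(6)] by (simp add: e_def k_def)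
  also have "(\<omega>\<^sup>2 * (?x \<bullet> ?s) + \<omega> * (1 - \<omega>) * (e \<bullet> (?x + ?s)) + (1 - \<omega>)\<^sup>2 * real k) / real k =
      \<omega>\<^sup>2 * M + (1 - \<omega>) * (\<omega> * A + (1 - \<omega>))"
    using k by (simp add: M_def A_def solution_mu_def power2_eq_square add_divide_distrib
        distrib_left mult.left_commute)
  also have "\<dots> \<le> M + (1 - \<omega>) * (A + 1)"
  proof (intro add_mono mult_left_mono)
    show "\<omega>\<^sup>2 * M \<le> M"
      using M assms(10,11) by (simp add: mult_left_le_one_le power_le_one)
    show "\<omega> * A \<le> A"
      using A assms(10,11) by (simp add: mult_left_le_one_le)
  qed (use assms(10,11) in simp_all)
  also have "\<dots> \<le> c_\<mu> + c_xs"
    using assms(15,16) cold by (simp add: M_def A_def)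
  also have "\<dots> \<le> c_w"
    by (rule assms(17))
  finally show ?thesis
    using cold by simp
qed

end
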